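(* Fix $K,r\in[1,\infty)$, and let $f_i:\mathbb R\to\mathbb R$, $i\in\mathbb N$, be $K$-Lipschitz continuous with $|f_i(0)|\le K$. Define $g_d:\mathbb R^d\to\mathbb R$ by $g_d(x)=\sum_{i=1}^d f_i(x_i)$. Then for all $d\in\mathbb N$ and $\varepsilon\in(0,1]$, there exists $\phi\in\mathcal N$ with $\mathcal R_{\mathrm{ReLU}}^\phi\in C(\mathbb R^d,\mathbb R)$ such that 1) $\sup_{x\in[-r,r]^d}|g_d(x)-\mathcal R_{\mathrm{ReLU}}^\phi(x)|\le\varepsilon$, 2) $\mathcal R_{\mathrm{ReLU}}^\phi$ is $\sqrt d\,K$-Lipschitz continuous on $\mathbb R^d$, and 3) $\mathcal P(\phi)\le\tfrac47\,10^3\,K^2\,r\,d^5\,\varepsilon^{-1}$.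
   Context: $\mathbb N=\{1,2,\dots\}$; Lipschitz continuity is with respect to the Euclidean norm. A skeleton is $\phi=[(V_1,b_1),\dots,(V_D,b_D)]$ with $D\in\mathbb N$, $l_0,\dots,l_D\in\mathbb N$, $V_k\in\mathbb R^{l_k\times l_{k-1}}$, $b_k\in\mathbb R^{l_k}$. $\mathcal N$ is the set of all skeletons, and the number of parameters is $\mathcal P(\phi)=\sum_{k=1}^D l_k(l_{k-1}+1)$. With $\mathrm{ReLU}(x)=\max\{x,0\}$ applied componentwise, the ReLU-realization is $\mathcal R_{\mathrm{ReLU}}^\phi=A_D\circ\mathrm{ReLU}\circ A_{D-1}\circ\cdots\circ\mathrm{ReLU}\circ A_1\in C(\mathbb R^{l_0},\mathbb R^{l_D})$ with $A_k(x)=V_kx+b_k$. *)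

theory Defs
  imports
    "HOL-Analysis.L2_Norm"
    "HOL-Analysis.Lipschitz"
    "Jordan_Normal_Form.Matrix"
begin

section \<open>Euclidean spaces of varying dimension\<close>

text \<open>The layer dimensions of a skeleton vary, so the \<open>n\<close>-dimensional Euclidean space is rendered
  as \<^term>\<open>carrier_vec n :: real vec set\<close>, with coordinates numbered from \<open>0\<close> to \<open>n - 1\<close>.\<close>

definition euclidean_vec_metric :: "nat \<Rightarrow> real vec metric" where
  "euclidean_vec_metric n = metric (carrier_vec n, \<lambda>x y. L2_set (\<lambda>i. x $ i - y $ i) {..<n})"

lemma Metric_space_euclidean_vec:
  "Metric_space (carrier_vec n) (\<lambda>x y :: real vec. L2_set (\<lambda>i. x $ i - y $ i) {..<n})"
proof
  fix x y z :: "real vec"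
  show "0 \<le> L2_set (\<lambda>i. x $ i - y $ i) {..<n}"
    by simp
  show "L2_set (\<lambda>i. x $ i - y $ i) {..<n} = L2_set (\<lambda>i. y $ i - x $ i) {..<n}"
    by (simp add: L2_set_def power2_commute)
  show "L2_set (\<lambda>i. x $ i - y $ i) {..<n} = 0 \<longleftrightarrow> x = y"
    if "x \<in> carrier_vec n" "y \<in> carrier_vec n"
    using that by (auto simp: L2_set_eq_0_iff intro!: eq_vecI)
  have "L2_set (\<lambda>i. x $ i - z $ i) {..<n} =
      L2_set (\<lambda>i. (x $ i - y $ i) + (y $ i - z $ i)) {..<n}"
    by simp
  also have "\<dots> \<le> L2_set (\<lambda>i. x $ i - y $ i) {..<n} + L2_set (\<lambda>i. y $ i - z $ i) {..<n}"
    by (rule L2_set_triangle_ineq)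
  finally show "L2_set (\<lambda>i. x $ i - z $ i) {..<n} \<le>
      L2_set (\<lambda>i. x $ i - y $ i) {..<n} + L2_set (\<lambda>i. y $ i - z $ i) {..<n}" .
qed

lemma mspace_euclidean_vec_metric [simp]: "mspace (euclidean_vec_metric n) = carrier_vec n"
  unfolding euclidean_vec_metric_def by (rule Metric_space.mspace_metric[OF Metric_space_euclidean_vec])

lemma mdist_euclidean_vec_metric [simp]:
  "mdist (euclidean_vec_metric n) = (\<lambda>x y. L2_set (\<lambda>i. x $ i - y $ i) {..<n})"
  unfolding euclidean_vec_metric_def by (rule Metric_space.mdist_metric[OF Metric_space_euclidean_vec])

text \<open>The version of \<^const>\<open>Lipschitz_continuous_map\<close> with an explicit constant.\<close>

definition Lipschitz_continuous_map_with ::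
    "real \<Rightarrow> 'a metric \<Rightarrow> 'b metric \<Rightarrow> ('a \<Rightarrow> 'b) \<Rightarrow> bool" where
  "Lipschitz_continuous_map_with L m1 m2 f \<longleftrightarrow>
     f \<in> mspace m1 \<rightarrow> mspace m2 \<and>
     (\<forall>x \<in> mspace m1. \<forall>y \<in> mspace m1. mdist m2 (f x) (f y) \<le> L * mdist m1 x y)"

lemma Lipschitz_continuous_map_with_imp:
  "Lipschitz_continuous_map_with L m1 m2 f \<Longrightarrow> Lipschitz_continuous_map m1 m2 f"
  by (auto simp: Lipschitz_continuous_map_with_def Lipschitz_continuous_map_def)

section \<open>Skeletons and their ReLU-realizations\<close>

text \<open>The list entry at position \<open>k - 1\<close> is the layer \<open>(V\<^sub>k, b\<^sub>k)\<close>, for \<open>k = 1, \<dots>, D\<close>, where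
  \<open>D\<close> is the length of the list.\<close>

type_synonym skeleton = "(real mat \<times> real vec) list"

definition layer_dim :: "skeleton \<Rightarrow> nat \<Rightarrow> nat" where
  "layer_dim \<phi> k = (if k = 0 then dim_col (fst (hd \<phi>)) else dim_row (fst (\<phi> ! (k - 1))))"

definition skeletons :: "skeleton set" where
  "skeletons = {\<phi>. length \<phi> \<ge> 1 \<and>
     (\<forall>k \<in> {0..length \<phi>}. layer_dim \<phi> k \<ge> 1) \<and>
     (\<forall>k \<in> {1..length \<phi>}.
        fst (\<phi> ! (k - 1)) \<in> carrier_mat (layer_dim \<phi> k) (layer_dim \<phi> (k - 1)) \<and>
        snd (\<phi> ! (k - 1)) \<in> carrier_vec (layer_dim \<phi> k))}"

definition num_params :: "skeleton \<Rightarrow> nat" where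
  "num_params \<phi> = (\<Sum>k = 1..length \<phi>. layer_dim \<phi> k * (layer_dim \<phi> (k - 1) + 1))"

definition affine_map :: "real mat \<times> real vec \<Rightarrow> real vec \<Rightarrow> real vec" where
  "affine_map l x = fst l *\<^sub>v x + snd l"

definition relu :: "real vec \<Rightarrow> real vec" where
  "relu x = map_vec (\<lambda>t. max t 0) x"

text \<open>The value on the empty list is irrelevant, since the empty list is not a skeleton.\<close>

fun relu_realization :: "skeleton \<Rightarrow> real vec \<Rightarrow> real vec" where
  "relu_realization [] = id"
| "relu_realization [l] = affine_map l"
| "relu_realization (l # l' # \<phi>) = relu_realization (l' # \<phi>) \<circ> relu \<circ> affine_map l"

end

theory Submission
  imports Defs
begin

text \<open>One hidden layer suffices. Each \<open>f\<^sub>i\<close> is interpolated linearly at \<open>N + 1\<close> equidistant knots of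
  \<open>[-r, r]\<close> and extended by constants; all slopes are bounded by \<open>K\<close>, so the interpolant \<open>p\<^sub>i\<close> is
  \<open>K\<close>-Lipschitz on the whole line, and it differs from \<open>f\<^sub>i\<close> by at most \<open>2 K h\<close>, where \<open>h = 2 r / N\<close>.
  With \<open>N = \<lceil>4 K r d / \<epsilon>\<rceil>\<close> the sum of the \<open>p\<^sub>i\<close> has error at most \<open>\<epsilon>\<close>. Cauchy--Schwarz
  gives the constant \<open>\<surd>d K\<close>. Each \<open>p\<^sub>i\<close> is a combination of the \<open>N + 1\<close> functions
  \<open>max (x - t\<^sub>j) 0\<close>, so the hidden layer has \<open>d (N + 1)\<close> neurons and the number of parameters is
  of order \<open>K r d\<^sup>3 / \<epsilon>\<close>.\<close>

section \<open>Piecewise linear interpolation\<close>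

text \<open>For nondecreasing \<open>t\<close>, the factor of \<open>s j\<close> vanishes left of
  \<open>t j\<close>, rises with slope 1 up to \<open>t (Suc j)\<close> and is constant afterwards,
  so the \<open>s j\<close> are the slopes between consecutive knots.\<close>

definition ramp_sum :: "nat \<Rightarrow> (nat \<Rightarrow> real) \<Rightarrow> (nat \<Rightarrow> real) \<Rightarrow> real \<Rightarrow> real" where
  "ramp_sum N s t x = (\<Sum>j<N. s j * (max (x - t j) 0 - max (x - t (Suc j)) 0))"

text \<open>Summation by parts: the coefficient at knot \<open>j\<close> is the jump of the slope
  there. The slope is 0 outside the knots, whence the special cases \<open>j = 0\<close> and
  \<open>j = N\<close>.\<close>

lemma ramp_sum_as_relu_sum:
  "ramp_sum N s t x =
     (\<Sum>j<Suc N. ((if j < N then s j else 0) - (if j = 0 then 0 else s (j - 1))) * max (x - t j) 0)"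
proof -
  have "(\<Sum>j<N. s j * max (x - t j) 0) = (\<Sum>j<Suc N. (if j < N then s j else 0) * max (x - t j) 0)"
    by simp
  moreover have "(\<Sum>j<N. s j * max (x - t (Suc j)) 0) =
      (\<Sum>j<Suc N. (if j = 0 then 0 else s (j - 1)) * max (x - t j) 0)"
    by (subst sum.lessThan_Suc_shift) simp
  ultimately show ?thesis
    unfolding ramp_sum_def by (simp only: right_diff_distrib left_diff_distrib sum_subtractf)
qed

text \<open>The ramps are nondecreasing, so increments can be bounded termwise by \<open>K\<close>
  times those of the ramps. The sum of all ramps telescopes to a function with slopes 0 and 1; no
  case distinction on the intervals containing \<open>x\<close> and \<open>y\<close> is
  needed.\<close>

lemma ramp_sum_lipschitz:
  assumes "mono t" and s: "\<And>j. \<bar>s j\<bar> \<le> K"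
  shows "K-lipschitz_on UNIV (ramp_sum N s t)"
proof -
  define q where "q j x = max (x - t j) 0 - max (x - t (Suc j)) 0" for j and x :: real
  have K: "0 \<le> K"
    using s[of 0] by linarith
  have le: "\<bar>ramp_sum N s t x - ramp_sum N s t y\<bar> \<le> K * (x - y)" if "y \<le> x" for x y
  proof -
    have q: "q j y \<le> q j x" for j
      using that monoD[OF \<open>mono t\<close>, of j "Suc j"] by (auto simp: q_def max_def)
    have "ramp_sum N s t x - ramp_sum N s t y = (\<Sum>j<N. s j * (q j x - q j y))"
      by (simp add: ramp_sum_def q_def sum_subtractf right_diff_distrib)
    also have "\<bar>\<dots>\<bar> \<le> (\<Sum>j<N. K * (q j x - q j y))"
    proof (rule order_trans[OF sum_abs sum_mono])
      show "\<bar>s j * (q j x - q j y)\<bar> \<le> K * (q j x - q j y)" for j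
        using q[of j] s[of j] by (simp add: abs_mult mult_right_mono)
    qed
    also have "\<dots> = K * ((\<Sum>j<N. q j x) - (\<Sum>j<N. q j y))"
      by (simp add: sum_distrib_left[symmetric] sum_subtractf)
    also have "\<dots> \<le> K * (x - y)"
    proof (rule mult_left_mono[OF _ K])
      have "(\<Sum>j<N. q j z) = max (z - t 0) 0 - max (z - t N) 0" for z
        unfolding q_def by (rule sum_lessThan_telescope')
      then show "(\<Sum>j<N. q j x) - (\<Sum>j<N. q j y) \<le> x - y"
        using that by (auto simp: max_def)
    qed
    finally show ?thesis .
  qed
  show ?thesis
  proof (rule lipschitz_onI[OF _ K])
    show "dist (ramp_sum N s t x) (ramp_sum N s t y) \<le> K * dist x y" for x y
      using le[of x y] le[of y x] by (cases "y \<le> x") (auto simp: dist_real_def abs_minus_commute)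
  qed
qed

text \<open>At \<open>t m\<close> the ramps with index below \<open>m\<close> have reached full
  height and the others have not started.\<close>

lemma ramp_sum_knot:
  assumes "mono t" and "m \<le> N"
  shows "ramp_sum N s t (t m) = (\<Sum>j<m. s j * (t (Suc j) - t j))"
proof -
  have "ramp_sum N s t (t m) = (\<Sum>j<N. if j < m then s j * (t (Suc j) - t j) else 0)"
    unfolding ramp_sum_def
  proof (rule sum.cong)
    fix j
    show "s j * (max (t m - t j) 0 - max (t m - t (Suc j)) 0) =
        (if j < m then s j * (t (Suc j) - t j) else 0)"
    proof (cases "j < m")
      case True
      then show ?thesis
        using monoD[OF \<open>mono t\<close>, of j m] monoD[OF \<open>mono t\<close>, of "Suc j" m] by (simp add: max_def)
    next
      case False
      then show ?thesis
        using monoD[OF \<open>mono t\<close>, of m j] monoD[OF \<open>mono t\<close>, of m "Suc j"] by (simp add: max_def)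
    qed
  qed simp
  also have "\<dots> = (\<Sum>j\<in>{..<N} \<inter> {j. j < m}. s j * (t (Suc j) - t j))"
    by (simp add: sum.inter_restrict)
  also have "{..<N} \<inter> {j. j < m} = {..<m}"
    using assms(2) by auto
  finally show ?thesis .
qed

text \<open>Both \<open>u\<close> and its interpolant are \<open>K\<close>-Lipschitz and agree at
  the knots, so at distance at most \<open>h\<close> from a knot they differ by at most
  \<open>2 * K * h\<close>. The knots do not depend on \<open>u\<close>, so all coordinates can
  share them.\<close>

lemma lipschitz_relu_interpolation:
  fixes u :: "real \<Rightarrow> real"
  assumes u: "K-lipschitz_on UNIV u" and r: "0 < r" and N: "0 < N"
    and t_eq: "\<And>j. t j = real j * (2 * r / real N) - r"
  shows "\<exists>c. K-lipschitz_on UNIV (\<lambda>x. u (- r) + (\<Sum>j<Suc N. c j * max (x - t j) 0)) \<and>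
    (\<forall>x\<in>{-r..r}. \<bar>u x - (u (- r) + (\<Sum>j<Suc N. c j * max (x - t j) 0))\<bar> \<le> 4 * K * r / real N)"
proof -
  define h where "h = 2 * r / real N"
  define s where "s j = (u (t (Suc j)) - u (t j)) / h" for j
  define p where "p x = u (- r) + ramp_sum N s t x" for x
  have h: "0 < h" and Nh: "real N * h = 2 * r"
    using r N by (auto simp: h_def)
  have t: "t j = real j * h - r" for j
    by (simp add: t_eq h_def)
  have step: "t (Suc j) - t j = h" for j
    by (simp add: t algebra_simps)
  have "mono t"
    using h by (auto simp: mono_def t intro: mult_right_mono)
  have u_le: "\<bar>u x - u y\<bar> \<le> K * \<bar>x - y\<bar>" for x y
    using lipschitz_onD[OF u, of x y] by (simp add: dist_real_def)
  have K: "0 \<le> K"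
    using u by (rule lipschitz_on_nonneg)
  have "\<bar>s j\<bar> \<le> K" for j
    using u_le[of "t (Suc j)" "t j"] h by (simp add: s_def step abs_divide divide_le_eq)
  then have "K-lipschitz_on UNIV (ramp_sum N s t)"
    by (rule ramp_sum_lipschitz[OF \<open>mono t\<close>])
  then have lip: "K-lipschitz_on UNIV p"
    by (simp add: p_def[abs_def] lipschitz_on_def)
  have knot: "p (t m) = u (t m)" if "m \<le> N" for m
  proof -
    have "ramp_sum N s t (t m) = (\<Sum>j<m. u (t (Suc j)) - u (t j))"
      using h by (simp add: ramp_sum_knot[OF \<open>mono t\<close> that] step s_def)
    also have "\<dots> = u (t m) - u (t 0)"
      by (rule sum_lessThan_telescope)
    finally show ?thesis
      by (simp add: p_def t)
  qed
  have err: "\<bar>u x - p x\<bar> \<le> 4 * K * r / real N" if x: "x \<in> {-r..r}" for x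
  proof -
    \<comment> \<open>The last knot not to the right of \<open>x\<close>; the value
      \<open>m = N\<close> occurs for \<open>x = r\<close>.\<close>
    define m where "m = nat \<lfloor>(x + r) / h\<rfloor>"
    have x0: "0 \<le> (x + r) / h"
      using x h by simp
    then have m: "real m \<le> (x + r) / h" "(x + r) / h < real m + 1"
      by (auto simp: m_def)
    have "(x + r) / h \<le> real N"
      using x h Nh by (simp add: divide_le_eq)
    then have "m \<le> N"
      using m(1) by linarith
    have "real m * h \<le> x + r" "x + r < (real m + 1) * h"
      using m h by (simp_all add: le_divide_eq divide_less_eq)
    then have dist: "\<bar>x - t m\<bar> \<le> h"
      by (simp add: t algebra_simps)
    have "\<bar>p x - p (t m)\<bar> \<le> K * \<bar>x - t m\<bar>"
      using lipschitz_onD[OF lip, of x "t m"] by (simp add: dist_real_def)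
    then have "\<bar>u x - p x\<bar> \<le> 2 * (K * \<bar>x - t m\<bar>)"
      using u_le[of x "t m"] knot[OF \<open>m \<le> N\<close>] by linarith
    also have "\<dots> \<le> 2 * (K * h)"
      using dist K by (simp add: mult_left_mono)
    also have "\<dots> = 4 * K * r / real N"
      by (simp add: h_def)
    finally show ?thesis .
  qed
  show ?thesis
    by (rule exI, rule conjI, rule lip[unfolded p_def[abs_def] ramp_sum_as_relu_sum],
        rule ballI, erule err[unfolded p_def ramp_sum_as_relu_sum])
qed

section \<open>Networks with one hidden layer\<close>

text \<open>Neuron \<open>k\<close> of the hidden layer computes \<open>max (x\<^sub>i - t\<^sub>j) 0\<close>, where \<open>k = i * m + j\<close> and \<open>j < m\<close>.\<close>

definition additive_net ::
    "nat \<Rightarrow> nat \<Rightarrow> (nat \<Rightarrow> nat \<Rightarrow> real) \<Rightarrow> (nat \<Rightarrow> real) \<Rightarrow> real \<Rightarrow> skeleton" where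
  "additive_net d m c t a =
     [(mat (d * m) d (\<lambda>(k, i). if i = k div m then 1 else 0), vec (d * m) (\<lambda>k. - t (k mod m))),
      (mat 1 (d * m) (\<lambda>(_, k). c (k div m) (k mod m)), vec 1 (\<lambda>_. a))]"

lemma additive_net_skeleton:
  assumes "0 < d" "0 < m"
  shows "additive_net d m c t a \<in> skeletons"
proof -
  have "{0..2::nat} = {0, 1, 2}" "{1..2::nat} = {1, 2}"
    by auto
  then show ?thesis
    using assms by (simp add: skeletons_def layer_dim_def additive_net_def numeral_2_eq_2 Suc_le_eq)
qed

lemma num_params_additive_net:
  "num_params (additive_net d m c t a) = d * m * (d + 1) + (d * m + 1)"
proof -
  have "{1..2::nat} = {1, 2}"
    by auto
  then show ?thesis
    by (simp add: num_params_def layer_dim_def additive_net_def numeral_2_eq_2)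
qed

text \<open>Undoes the flat numbering of the hidden neurons: the range splits into \<open>d\<close>
  blocks of length \<open>m\<close>, one for each coordinate.\<close>

lemma sum_div_mod:
  fixes F :: "nat \<Rightarrow> nat \<Rightarrow> real"
  shows "(\<Sum>k<d * m. F (k div m) (k mod m)) = (\<Sum>i<d. \<Sum>j<m. F i j)"
proof -
  have "(\<Sum>k<d * m. F (k div m) (k mod m)) =
      (\<Sum>i<d. \<Sum>k = i * m..<i * m + m. F (k div m) (k mod m))"
    by (rule sum.nat_group[symmetric])
  also have "\<dots> = (\<Sum>i<d. \<Sum>j<m. F i j)"
  proof (rule sum.cong[OF refl])
    fix i
    have "(\<Sum>k = i * m..<i * m + m. F (k div m) (k mod m)) =
        (\<Sum>j = 0..<m. F ((j + i * m) div m) ((j + i * m) mod m))"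
      using sum.shift_bounds_nat_ivl[of "\<lambda>k. F (k div m) (k mod m)" 0 "i * m" m]
      by (simp add: add.commute)
    also have "\<dots> = (\<Sum>j<m. F i j)"
      by (auto simp: lessThan_atLeast0 intro!: sum.cong)
    finally show "(\<Sum>k = i * m..<i * m + m. F (k div m) (k mod m)) = (\<Sum>j<m. F i j)" .
  qed
  finally show ?thesis .
qed

lemma relu_realization_additive_net:
  assumes x: "x \<in> carrier_vec d"
  shows "relu_realization (additive_net d m c t a) x =
    vec 1 (\<lambda>_. a + (\<Sum>i<d. \<Sum>j<m. c i j * max (x $ i - t j) 0))"
proof -
  have hidden: "relu (affine_map (mat (d * m) d (\<lambda>(k, i). if i = k div m then 1 else 0),
      vec (d * m) (\<lambda>k. - t (k mod m))) x) =
      vec (d * m) (\<lambda>k. max (x $ (k div m) - t (k mod m)) 0)" (is "?l = ?r")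
  proof (rule eq_vecI)
    fix k
    assume "k < dim_vec ?r"
    then have k: "k < d * m"
      by simp
    then have "k div m < d"
      by (simp add: less_mult_imp_div_less)
    \<comment> \<open>Each row of the first weight matrix has a single entry 1, which selects one
      coordinate.\<close>
    then have "(\<Sum>i = 0..<d. (if i = k div m then 1 else 0) * x $ i) = x $ (k div m)"
      by (subst sum.mono_neutral_right[of _ "{k div m}"]) auto
    then show "?l $ k = ?r $ k"
      using k x by (simp add: relu_def affine_map_def scalar_prod_def)
  qed (simp add: relu_def affine_map_def)
  have "relu_realization (additive_net d m c t a) x =
      vec 1 (\<lambda>_. a + (\<Sum>k<d * m. c (k div m) (k mod m) * max (x $ (k div m) - t (k mod m)) 0))"
    by (auto simp: additive_net_def hidden) (auto simp: affine_map_def scalar_prod_def lessThan_atLeast0)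
  then show ?thesis
    by (simp only: sum_div_mod[of "\<lambda>i j. c i j * max (x $ i - t j) 0"])
qed

section \<open>Lipschitz constants of sums of univariate functions\<close>

lemma L2_set_singleton_vec:
  "L2_set (\<lambda>i. vec 1 (\<lambda>_. a) $ i - vec 1 (\<lambda>_. b) $ i) {..<1} = \<bar>a - b :: real\<bar>"
  by (simp add: L2_set_def)

lemma additive_function_lipschitz:
  fixes p :: "nat \<Rightarrow> real \<Rightarrow> real"
  assumes p: "\<And>i. K-lipschitz_on UNIV (p i)"
  shows "Lipschitz_continuous_map_with (sqrt (real d) * K) (euclidean_vec_metric d)
    (euclidean_vec_metric 1) (\<lambda>x. vec 1 (\<lambda>_. \<Sum>i<d. p i (x $ i)))"
proof -
  have K: "0 \<le> K"
    using p by (rule lipschitz_on_nonneg)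
  have "\<bar>(\<Sum>i<d. p i (x $ i)) - (\<Sum>i<d. p i (y $ i))\<bar> \<le>
      sqrt (real d) * K * L2_set (\<lambda>i. x $ i - y $ i) {..<d}" for x y :: "real vec"
  proof -
    have "\<bar>(\<Sum>i<d. p i (x $ i)) - (\<Sum>i<d. p i (y $ i))\<bar> \<le> (\<Sum>i<d. K * \<bar>x $ i - y $ i\<bar>)"
      unfolding sum_subtractf[symmetric]
    proof (rule order_trans[OF sum_abs sum_mono])
      show "\<bar>p i (x $ i) - p i (y $ i)\<bar> \<le> K * \<bar>x $ i - y $ i\<bar>" for i
        using lipschitz_onD[OF p, of "x $ i" "y $ i" i] by (simp add: dist_real_def)
    qed
    \<comment> \<open>The factor 1 prepares Cauchy-Schwarz against the constant vector, whose norm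
      is \<open>sqrt d\<close>.\<close>
    also have "\<dots> = K * (\<Sum>i<d. \<bar>1\<bar> * \<bar>x $ i - y $ i\<bar>)"
      by (simp add: sum_distrib_left)
    also have "\<dots> \<le> K * (L2_set (\<lambda>_. 1) {..<d} * L2_set (\<lambda>i. x $ i - y $ i) {..<d})"
      by (rule mult_left_mono[OF L2_set_mult_ineq K])
    also have "L2_set (\<lambda>_. 1) {..<d} = sqrt (real d)"
      by (simp add: L2_set_def)
    finally show ?thesis
      by (simp add: ac_simps)
  qed
  then show ?thesis
    by (simp add: Lipschitz_continuous_map_with_def L2_set_singleton_vec del: lessThan_Suc One_nat_def)
qed

text \<open>Serves to replace the realization by its closed form, which is established only on
  \<open>carrier_vec d\<close>.\<close>

lemma Lipschitz_continuous_map_with_cong: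
  assumes "\<And>x. x \<in> mspace m1 \<Longrightarrow> f x = g x"
  shows "Lipschitz_continuous_map_with L m1 m2 f \<longleftrightarrow> Lipschitz_continuous_map_with L m1 m2 g"
  using assms by (auto simp: Lipschitz_continuous_map_with_def Pi_iff)

section \<open>Parameter count\<close>

lemma num_params_bound:
  fixes K r \<epsilon> :: real
  assumes "K \<ge> 1" "r \<ge> 1" "d \<ge> 1" "0 < \<epsilon>" "\<epsilon> \<le> 1"
    and N: "real N \<le> 4 * K * r * real d / \<epsilon> + 1"
  shows "real (d * Suc N * (d + 1) + (d * Suc N + 1)) \<le>
    4 / 7 * 10 ^ 3 * K\<^sup>2 * r * real d ^ 5 * inverse \<epsilon>"
proof -
  define D where "D = real d"
  define A where "A = K * r * D / \<epsilon>"
  have D: "1 \<le> D"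
    using assms(3) by (simp add: D_def)
  have "1 \<le> K * r * D"
    using assms(1,2) D by (metis mult_ge1_I)
  then have A: "1 \<le> A"
    using assms(4,5) by (simp add: A_def le_divide_eq)
  \<comment> \<open>By \<open>N\<close>, the left side is at most \<open>4 * A + 2\<close>, and
    \<open>1 \<le> A\<close> absorbs the 2.\<close>
  have N': "real N + 1 \<le> 6 * A"
    using N A by (simp add: A_def D_def)
  have "real (d * Suc N * (d + 1) + (d * Suc N + 1)) = (real N + 1) * (D * (D + 2)) + 1"
    by (simp add: D_def algebra_simps)
  \<comment> \<open>Uses \<open>D + 2 \<le> 3 * D\<close>; the total constant is
    \<open>6 * 3 + 1 = 19\<close>, far below 4000/7.\<close>
  also have "\<dots> \<le> (6 * A) * (D * (3 * D)) + A * D ^ 2"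
  proof (rule add_mono)
    show "(real N + 1) * (D * (D + 2)) \<le> 6 * A * (D * (3 * D))"
      using D A N' by (intro mult_mono) auto
    show "1 \<le> A * D ^ 2"
      using A D by (metis mult_ge1_I one_le_power)
  qed
  also have "\<dots> = 19 * (K * (r * inverse \<epsilon>) * D ^ 3)"
    by (simp add: A_def field_simps power2_eq_square power3_eq_cube)
  also have "\<dots> \<le> 4 / 7 * 10 ^ 3 * (K\<^sup>2 * (r * inverse \<epsilon>) * D ^ 5)"
  proof (rule mult_mono)
    have "K \<le> K\<^sup>2"
      using assms(1) by (simp add: power2_eq_square)
    moreover have "D ^ 3 \<le> D ^ 5"
      using D by (intro power_increasing) auto
    ultimately show "K * (r * inverse \<epsilon>) * D ^ 3 \<le> K\<^sup>2 * (r * inverse \<epsilon>) * D ^ 5"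
      using assms D by (intro mult_mono) auto
  qed (use assms D in auto)
  finally show ?thesis
    by (simp add: D_def ac_simps)
qed

section \<open>Choice of the network for given dimension and accuracy\<close>

theorem proposition28:
  fixes K r :: real
    and f :: "nat \<Rightarrow> real \<Rightarrow> real"
    and g :: "nat \<Rightarrow> real vec \<Rightarrow> real"
  assumes "K \<ge> 1" and "r \<ge> 1"
    and "\<And>i. i \<ge> 1 \<Longrightarrow> K-lipschitz_on UNIV (f i)"
    and "\<And>i. i \<ge> 1 \<Longrightarrow> \<bar>f i 0\<bar> \<le> K"
    and "\<And>d x. d \<ge> 1 \<Longrightarrow> x \<in> carrier_vec d \<Longrightarrow> g d x = (\<Sum>i = 1..d. f i (x $ (i - 1)))"
  shows "\<forall>d \<ge> 1. \<forall>\<epsilon> \<in> {0<..1}. \<exists>\<phi> \<in> skeletons.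
    layer_dim \<phi> 0 = d \<and> layer_dim \<phi> (length \<phi>) = 1 \<and>
    continuous_map (mtopology_of (euclidean_vec_metric d)) (mtopology_of (euclidean_vec_metric 1))
      (relu_realization \<phi>) \<and>
    (SUP x \<in> {x \<in> carrier_vec d. \<forall>i < d. x $ i \<in> {-r..r}}.
      ereal \<bar>g d x - relu_realization \<phi> x $ 0\<bar>) \<le> ereal \<epsilon> \<and>
    Lipschitz_continuous_map_with (sqrt (real d) * K) (euclidean_vec_metric d) (euclidean_vec_metric 1)
      (relu_realization \<phi>) \<and>
    real (num_params \<phi>) \<le> 4 / 7 * 10 ^ 3 * K\<^sup>2 * r * real d ^ 5 * inverse \<epsilon>"
proof (intro allI impI ballI)
  fix d :: nat and \<epsilon> :: real
  assume d: "1 \<le> d" and "\<epsilon> \<in> {0<..1}"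
  then have eps: "0 < \<epsilon>" "\<epsilon> \<le> 1"
    by auto
  \<comment> \<open>With this \<open>N\<close>, the \<open>d\<close> coordinate errors
    \<open>4 * K * r / N\<close> add up to at most \<open>\<epsilon>\<close>; rounding up costs at
    most 1, as the parameter count requires.\<close>
  define N where "N = nat \<lceil>4 * K * r * real d / \<epsilon>\<rceil>"
  have B: "0 < 4 * K * r * real d / \<epsilon>"
    using assms(1,2) d eps by simp
  then have N_ge: "4 * K * r * real d / \<epsilon> \<le> real N" and N_le: "real N \<le> 4 * K * r * real d / \<epsilon> + 1"
    by (simp_all add: N_def)
  have N: "0 < N"
    using B N_ge by (cases "N = 0") auto
  define t where "t j = real j * (2 * r / real N) - r" for j
  \<comment> \<open>The functions are numbered from 1 but the coordinates from 0, hence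
    \<open>Suc i\<close>, which also satisfies \<open>i \<ge> 1\<close> in the Lipschitz
    assumption.\<close>
  have "\<forall>i. \<exists>c. K-lipschitz_on UNIV
        (\<lambda>x. f (Suc i) (- r) + (\<Sum>j<Suc N. c j * max (x - t j) 0)) \<and>
      (\<forall>x\<in>{-r..r}. \<bar>f (Suc i) x - (f (Suc i) (- r) + (\<Sum>j<Suc N. c j * max (x - t j) 0))\<bar> \<le>
        4 * K * r / real N)"
    using assms(2,3) N by (intro allI lipschitz_relu_interpolation) (auto simp: t_def)
  from choice[OF this] obtain c where c: "\<forall>i. K-lipschitz_on UNIV
        (\<lambda>x. f (Suc i) (- r) + (\<Sum>j<Suc N. c i j * max (x - t j) 0)) \<and>
      (\<forall>x\<in>{-r..r}. \<bar>f (Suc i) x - (f (Suc i) (- r) + (\<Sum>j<Suc N. c i j * max (x - t j) 0))\<bar> \<le>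
        4 * K * r / real N)"
    by (elim exE)
  define p where "p i x = f (Suc i) (- r) + (\<Sum>j<Suc N. c i j * max (x - t j) 0)" for i x
  have p_lip: "K-lipschitz_on UNIV (p i)" for i
    unfolding p_def[abs_def] using c by (rule allE) (rule conjunct1)
  have p_err: "\<bar>f (Suc i) x - p i x\<bar> \<le> 4 * K * r / real N" if "x \<in> {-r..r}" for i x
    using conjunct2[OF spec[OF c, of i], THEN bspec, OF that] by (simp only: p_def)
  \<comment> \<open>The constant terms of the \<open>d\<close> interpolants merge into the single
    output bias.\<close>
  define \<phi> where "\<phi> = additive_net d (Suc N) c t (\<Sum>i<d. f (Suc i) (- r))"
  have real: "relu_realization \<phi> x = vec 1 (\<lambda>_. \<Sum>i<d. p i (x $ i))" if "x \<in> carrier_vec d" for x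
    by (simp add: \<phi>_def relu_realization_additive_net[OF that] p_def sum.distrib del: sum.lessThan_Suc)
  have lip: "Lipschitz_continuous_map_with (sqrt (real d) * K) (euclidean_vec_metric d)
      (euclidean_vec_metric 1) (relu_realization \<phi>)"
    by (rule Lipschitz_continuous_map_with_cong[THEN iffD2, OF _ additive_function_lipschitz[OF p_lip]])
      (simp add: real)
  have err: "\<bar>g d x - relu_realization \<phi> x $ 0\<bar> \<le> \<epsilon>"
    if x: "x \<in> carrier_vec d" "\<forall>i < d. x $ i \<in> {-r..r}" for x
  proof -
    have "g d x = (\<Sum>i<d. f (Suc i) (x $ i))"
      using assms(5)[OF d x(1)] by (simp add: sum.atLeast1_atMost_eq)
    then have "\<bar>g d x - relu_realization \<phi> x $ 0\<bar> = \<bar>\<Sum>i<d. f (Suc i) (x $ i) - p i (x $ i)\<bar>"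
      by (simp add: real[OF x(1)] sum_subtractf)
    also have "\<dots> \<le> (\<Sum>i<d. 4 * K * r / real N)"
      using x(2) p_err by (intro order_trans[OF sum_abs sum_mono]) simp
    also have "\<dots> \<le> \<epsilon>"
      using N_ge N eps by (simp add: field_simps)
    finally show ?thesis .
  qed
  show "\<exists>\<phi> \<in> skeletons.
    layer_dim \<phi> 0 = d \<and> layer_dim \<phi> (length \<phi>) = 1 \<and>
    continuous_map (mtopology_of (euclidean_vec_metric d)) (mtopology_of (euclidean_vec_metric 1))
      (relu_realization \<phi>) \<and>
    (SUP x \<in> {x \<in> carrier_vec d. \<forall>i < d. x $ i \<in> {-r..r}}.
      ereal \<bar>g d x - relu_realization \<phi> x $ 0\<bar>) \<le> ereal \<epsilon> \<and>
    Lipschitz_continuous_map_with (sqrt (real d) * K) (euclidean_vec_metric d) (euclidean_vec_metric 1)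
      (relu_realization \<phi>) \<and>
    real (num_params \<phi>) \<le> 4 / 7 * 10 ^ 3 * K\<^sup>2 * r * real d ^ 5 * inverse \<epsilon>"
  proof (intro bexI[of _ \<phi>] conjI)
    show "\<phi> \<in> skeletons"
      using d by (simp add: \<phi>_def additive_net_skeleton)
    show "layer_dim \<phi> 0 = d" "layer_dim \<phi> (length \<phi>) = 1"
      by (simp_all add: \<phi>_def additive_net_def layer_dim_def)
    show "continuous_map (mtopology_of (euclidean_vec_metric d)) (mtopology_of (euclidean_vec_metric 1))
        (relu_realization \<phi>)"
      using lip by (intro Lipschitz_continuous_imp_continuous_map Lipschitz_continuous_map_with_imp)
    show "(SUP x \<in> {x \<in> carrier_vec d. \<forall>i < d. x $ i \<in> {-r..r}}.
        ereal \<bar>g d x - relu_realization \<phi> x $ 0\<bar>) \<le> ereal \<epsilon>"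
      using err by (intro SUP_least) simp
    show "real (num_params \<phi>) \<le> 4 / 7 * 10 ^ 3 * K\<^sup>2 * r * real d ^ 5 * inverse \<epsilon>"
      unfolding \<phi>_def num_params_additive_net using assms(1,2) d eps N_le by (rule num_params_bound)
  qed (rule lip)
qed

end
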